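(* For any policy $\pi : \mathcal{X} \to \mathcal{U}$ and any extended class-$\kappa$ function $\alpha$, the policy value function $$V^{h,\pi}(x_0) = \sup_{t \ge 0} h(x^\pi_t)$$ is a control barrier function (CBF) for the system $\dot{x} = f(x) + g(x)u$ with avoid set $\mathcal{A} = \{x \in \mathcal{X} : h(x) > 0\}$.
   Context: Setting: continuous-time control-affine dynamics $\dot{x} = f(x) + g(x)u$ with state $x \in \mathcal{X} \subseteq \mathbb{R}^{n_x}$, control $u \in \mathcal{U} \subseteq \mathbb{R}^{n_u}$, and $f, g$ locally Lipschitz continuous. The avoid (unsafe) set $\mathcal{A} \subset \mathcal{X}$ is $\mathcal{A} = \{x \in \mathcal{X} : h(x) > 0\}$ for a continuous function $h : \mathcal{X} \to \mathbb{R}$. A policy is a map $\pi : \mathcal{X} \to \mathcal{U}$, and $x^\pi_t$ denotes the resulting state at time $t$ when starting from $x_0$ and following $\pi$, i.e. applying $u = \pi(x)$. An extended class-$\kappa$ function is a continuous, strictly increasing function $\alpha : \mathbb{R} \to \mathbb{R}$ with $\alpha(0) = 0$. A continuously differentiable function $B : \mathcal{X} \to \mathbb{R}$ is a CBF, with respect to the avoid set $\mathcal{A}$ and an extended class-$\kappa$ function $\alpha$, if (i) $B(x) > 0$ for all $x \in \mathcal{A}$, and (ii) $B(x) \le 0$ implies $\inf_{u \in \mathcal{U}} \left[ L_f B(x) + L_g B(x)\, u \right] \le -\alpha(B(x))$, where $L_f B = \nabla B^{\mathsf T} f$ and $L_g B = \nabla B^{\mathsf T} g$.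
   Formalization: Assumes that from every initial state the closed loop has a unique classical solution staying in X for all t ≥ 0, that h is bounded above along each trajectory, and that the policy value function is continuously differentiable (it can fail to be: f = g = 0, h(x) = |x|). *)

theory Defs
  imports "HOL-Analysis.Analysis"
begin

definition extended_class_kappa :: "(real \<Rightarrow> real) \<Rightarrow> bool" where
  "extended_class_kappa \<alpha> \<longleftrightarrow> continuous_on UNIV \<alpha> \<and> strict_mono \<alpha> \<and> \<alpha> 0 = 0"

definition avoid_set :: "'a set \<Rightarrow> ('a \<Rightarrow> real) \<Rightarrow> 'a set" where
  "avoid_set X h = {x \<in> X. h x > 0}"

(* The library notion is for time-dependent maps; we use it with a dummy time argument. *)
definition locally_lipschitz_on :: "'a::metric_space set \<Rightarrow> ('a \<Rightarrow> 'b::metric_space) \<Rightarrow> bool" where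
  "locally_lipschitz_on X f \<longleftrightarrow> local_lipschitz (UNIV :: real set) X (\<lambda>_. f)"

(* Classical solutions of x' = f x + g x u with u = \<pi> x, defined for all t >= 0 and staying
   in X.  The derivative is one-sided at t = 0 only; values at t < 0 are irrelevant. *)
definition closed_loop_solution ::
  "(real^'n) set \<Rightarrow> (real^'n \<Rightarrow> real^'n) \<Rightarrow> (real^'n \<Rightarrow> real^'m^'n) \<Rightarrow> (real^'n \<Rightarrow> real^'m)
    \<Rightarrow> real^'n \<Rightarrow> (real \<Rightarrow> real^'n) \<Rightarrow> bool" where
  "closed_loop_solution X f g \<pi> x0 \<xi> \<longleftrightarrow>
     \<xi> 0 = x0 \<and>
     (\<forall>t\<ge>0. \<xi> t \<in> X \<and>
        (\<xi> has_vector_derivative (f (\<xi> t) + g (\<xi> t) *v \<pi> (\<xi> t))) (at t within {0..}))"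

definition closed_loop_well_posed ::
  "(real^'n) set \<Rightarrow> (real^'n \<Rightarrow> real^'n) \<Rightarrow> (real^'n \<Rightarrow> real^'m^'n) \<Rightarrow> (real^'n \<Rightarrow> real^'m)
    \<Rightarrow> bool" where
  "closed_loop_well_posed X f g \<pi> \<longleftrightarrow>
     (\<forall>x0\<in>X. \<exists>\<xi>. closed_loop_solution X f g \<pi> x0 \<xi> \<and>
        (\<forall>\<xi>'. closed_loop_solution X f g \<pi> x0 \<xi>' \<longrightarrow> (\<forall>t\<ge>0. \<xi>' t = \<xi> t)))"

(* Meaningful for x0 in X and t >= 0 under closed_loop_well_posed, in which case the
   choice of the solution does not matter. *)
definition closed_loop_state ::
  "(real^'n) set \<Rightarrow> (real^'n \<Rightarrow> real^'n) \<Rightarrow> (real^'n \<Rightarrow> real^'m^'n) \<Rightarrow> (real^'n \<Rightarrow> real^'m)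
    \<Rightarrow> real^'n \<Rightarrow> real \<Rightarrow> real^'n" where
  "closed_loop_state X f g \<pi> x0 t = (SOME \<xi>. closed_loop_solution X f g \<pi> x0 \<xi>) t"

(* A supremum in the reals: meaningful when h is bounded above along the trajectory. *)
definition policy_value ::
  "(real^'n) set \<Rightarrow> (real^'n \<Rightarrow> real^'n) \<Rightarrow> (real^'n \<Rightarrow> real^'m^'n) \<Rightarrow> (real^'n \<Rightarrow> real)
    \<Rightarrow> (real^'n \<Rightarrow> real^'m) \<Rightarrow> real^'n \<Rightarrow> real" where
  "policy_value X f g h \<pi> x0 = (SUP t\<in>{0..}. h (closed_loop_state X f g \<pi> x0 t))"

(* G is a continuous gradient of B on X.  For open X this is the usual gradient, which is
   unique; the derivative relative to X makes sense of it for arbitrary X as well. *)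
definition continuous_gradient_on ::
  "(real^'n) set \<Rightarrow> (real^'n \<Rightarrow> real) \<Rightarrow> (real^'n \<Rightarrow> real^'n) \<Rightarrow> bool" where
  "continuous_gradient_on X B G \<longleftrightarrow>
     continuous_on X G \<and> (\<forall>x\<in>X. (B has_derivative (\<lambda>v. G x \<bullet> v)) (at x within X))"

definition continuously_differentiable_on :: "(real^'n) set \<Rightarrow> (real^'n \<Rightarrow> real) \<Rightarrow> bool" where
  "continuously_differentiable_on X B \<longleftrightarrow> (\<exists>G. continuous_gradient_on X B G)"

(* Lie derivatives along f and along the columns of g, in terms of the gradient G;
   lie_matrix is the row vector G^T g. *)
definition lie_vector :: "(real^'n \<Rightarrow> real^'n) \<Rightarrow> (real^'n \<Rightarrow> real^'n) \<Rightarrow> real^'n \<Rightarrow> real" where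
  "lie_vector G f x = G x \<bullet> f x"

definition lie_matrix ::
  "(real^'n \<Rightarrow> real^'n) \<Rightarrow> (real^'n \<Rightarrow> real^'m^'n) \<Rightarrow> real^'n \<Rightarrow> real^'m" where
  "lie_matrix G g x = G x v* g x"

(* The infimum is taken in the extended reals, since it may be -\<infinity> for unbounded U.
   Where the gradient relative to X is not unique (X not open), the decrease condition is
   required for every continuous gradient of B. *)
definition control_barrier_function ::
  "(real^'n) set \<Rightarrow> (real^'m) set \<Rightarrow> (real^'n \<Rightarrow> real^'n) \<Rightarrow> (real^'n \<Rightarrow> real^'m^'n)
    \<Rightarrow> (real^'n) set \<Rightarrow> (real \<Rightarrow> real) \<Rightarrow> (real^'n \<Rightarrow> real) \<Rightarrow> bool" where
  "control_barrier_function X U f g A \<alpha> B \<longleftrightarrow>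
     continuously_differentiable_on X B \<and>
     (\<forall>x\<in>A. B x > 0) \<and>
     (\<forall>G. continuous_gradient_on X B G \<longrightarrow>
        (\<forall>x\<in>X. B x \<le> 0 \<longrightarrow>
           (INF u\<in>U. ereal (lie_vector G f x + lie_matrix G g x \<bullet> u)) \<le> ereal (- \<alpha> (B x))))"

end

theory Submission imports Defs begin

text \<open>
  The value of a state is the supremum of \<open>h\<close> over the whole closed-loop trajectory that starts
  there.  By the semigroup property of the closed loop, the trajectory starting at a later state is
  a tail of the original one, so its supremum runs over fewer values: the policy value cannot
  increase along closed-loop trajectories.  Hence its derivative along \<open>f + g \<pi>\<close>
  is nonpositive at every state (\<open>policy_value_lie_derivative_nonpos\<close>).  Where the
  value is nonpositive, so is its image under \<open>\<alpha>\<close>, and the control \<open>\<pi> x\<close> is therefore a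
  witness for the decrease condition.  Positivity on the avoid set is
  the contribution of time \<open>0\<close> to the supremum.
\<close>

lemma closed_loop_state_solution:
  assumes "closed_loop_well_posed X f g \<pi>" "x0 \<in> X"
  shows "closed_loop_solution X f g \<pi> x0 (closed_loop_state X f g \<pi> x0)"
proof -
  have "\<exists>\<xi>. closed_loop_solution X f g \<pi> x0 \<xi>"
    using assms unfolding closed_loop_well_posed_def by blast
  then have "closed_loop_solution X f g \<pi> x0 (SOME \<xi>. closed_loop_solution X f g \<pi> x0 \<xi>)"
    by (rule someI_ex)
  moreover have "closed_loop_state X f g \<pi> x0 = (SOME \<xi>. closed_loop_solution X f g \<pi> x0 \<xi>)"
    by (rule ext) (simp add: closed_loop_state_def)
  ultimately show ?thesis
    by simp
qed

lemma closed_loop_state_unique: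
  assumes "closed_loop_well_posed X f g \<pi>" "closed_loop_solution X f g \<pi> x0 \<xi>"
    and "x0 \<in> X" "t \<ge> 0"
  shows "closed_loop_state X f g \<pi> x0 t = \<xi> t"
  using assms closed_loop_state_solution[OF assms(1,3)]
  unfolding closed_loop_well_posed_def by metis

text \<open>The closed loop is autonomous: neither \<open>f + g \<pi>\<close> nor the state constraint depends on time.\<close>

lemma closed_loop_solution_shift:
  assumes sol: "closed_loop_solution X f g \<pi> x0 \<xi>" and "s \<ge> 0"
  shows "closed_loop_solution X f g \<pi> (\<xi> s) (\<lambda>t. \<xi> (s + t))"
  unfolding closed_loop_solution_def
proof (intro conjI allI impI)
  fix t :: real
  assume "t \<ge> 0"
  with \<open>s \<ge> 0\<close> have "s + t \<ge> 0"
    by simp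
  with sol show "\<xi> (s + t) \<in> X"
    unfolding closed_loop_solution_def by blast
  let ?v = "f (\<xi> (s + t)) + g (\<xi> (s + t)) *v \<pi> (\<xi> (s + t))"
  have "(\<xi> has_vector_derivative ?v) (at (s + t) within {0..})"
    using sol \<open>s + t \<ge> 0\<close> unfolding closed_loop_solution_def by blast
  then have "(\<xi> has_vector_derivative ?v) (at (s + t) within (\<lambda>t. s + t) ` {0..})"
    by (rule has_vector_derivative_within_subset) (use \<open>s \<ge> 0\<close> in auto)
  moreover have "((\<lambda>t. s + t) has_vector_derivative 1) (at t within {0..})"
    by (auto intro!: derivative_eq_intros)
  ultimately have "(\<xi> \<circ> (\<lambda>t. s + t) has_vector_derivative 1 *\<^sub>R ?v) (at t within {0..})"
    by (intro vector_diff_chain_within)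
  then show "((\<lambda>t. \<xi> (s + t)) has_vector_derivative ?v) (at t within {0..})"
    by (simp add: o_def)
qed simp

lemma closed_loop_state_semigroup:
  assumes wp: "closed_loop_well_posed X f g \<pi>" and "x0 \<in> X" "s \<ge> 0" "t \<ge> 0"
  shows "closed_loop_state X f g \<pi> (closed_loop_state X f g \<pi> x0 s) t
    = closed_loop_state X f g \<pi> x0 (s + t)"
proof (rule closed_loop_state_unique[OF wp])
  have sol: "closed_loop_solution X f g \<pi> x0 (closed_loop_state X f g \<pi> x0)"
    by (rule closed_loop_state_solution) fact+
  then show "closed_loop_solution X f g \<pi> (closed_loop_state X f g \<pi> x0 s)
      (\<lambda>t. closed_loop_state X f g \<pi> x0 (s + t))"
    by (rule closed_loop_solution_shift) fact
  show "closed_loop_state X f g \<pi> x0 s \<in> X"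
    using sol \<open>s \<ge> 0\<close> unfolding closed_loop_solution_def by blast
qed fact

lemma le_policy_value:
  assumes "closed_loop_well_posed X f g \<pi>" "x0 \<in> X"
    and "bdd_above ((\<lambda>t. h (closed_loop_state X f g \<pi> x0 t)) ` {0..})"
  shows "h x0 \<le> policy_value X f g h \<pi> x0"
proof -
  have "closed_loop_state X f g \<pi> x0 0 = x0"
    using closed_loop_state_solution[OF assms(1,2)] unfolding closed_loop_solution_def by blast
  then show ?thesis
    using cSUP_upper[OF _ assms(3), of 0] by (simp add: policy_value_def)
qed

text \<open>The states that follow the state at time \<open>s\<close> form a tail of the trajectory of \<open>x0\<close>.\<close>

lemma policy_value_antimono_along_trajectory:
  assumes wp: "closed_loop_well_posed X f g \<pi>" and "x0 \<in> X" "s \<ge> 0"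
    and bdd: "bdd_above ((\<lambda>t. h (closed_loop_state X f g \<pi> x0 t)) ` {0..})"
  shows "policy_value X f g h \<pi> (closed_loop_state X f g \<pi> x0 s) \<le> policy_value X f g h \<pi> x0"
  unfolding policy_value_def
proof (rule cSUP_least)
  fix t :: real
  assume "t \<in> {0..}"
  then have "h (closed_loop_state X f g \<pi> (closed_loop_state X f g \<pi> x0 s) t)
      = h (closed_loop_state X f g \<pi> x0 (s + t))"
    using closed_loop_state_semigroup[OF wp \<open>x0 \<in> X\<close> \<open>s \<ge> 0\<close>] by simp
  also have "\<dots> \<le> (SUP t\<in>{0..}. h (closed_loop_state X f g \<pi> x0 t))"
    using bdd \<open>s \<ge> 0\<close> \<open>t \<in> {0..}\<close> by (intro cSUP_upper) auto
  finally show "h (closed_loop_state X f g \<pi> (closed_loop_state X f g \<pi> x0 s) t)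
      \<le> (SUP t\<in>{0..}. h (closed_loop_state X f g \<pi> x0 t))" .
qed simp

text \<open>
  At the end point \<open>a\<close> only an inequality holds, because the limit is over difference
  quotients from one side.
\<close>

lemma right_derivative_nonpos_at_max:
  fixes \<phi> :: "real \<Rightarrow> real"
  assumes deriv: "(\<phi> has_real_derivative d) (at a within {a..})"
    and max: "\<And>t. t \<ge> a \<Longrightarrow> \<phi> t \<le> \<phi> a"
  shows "d \<le> 0"
proof (rule tendsto_upperbound)
  show "((\<lambda>t. (\<phi> t - \<phi> a) / (t - a)) \<longlongrightarrow> d) (at a within {a..})"
    using deriv by (simp add: has_field_derivative_iff)
  show "\<forall>\<^sub>F t in at a within {a..}. (\<phi> t - \<phi> a) / (t - a) \<le> 0"
    unfolding eventually_at_topological using max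
    by (auto intro!: divide_nonpos_nonneg)
  show "at a within {a..} \<noteq> bot"
    by (simp add: at_within_Ici_at_right)
qed

text \<open>
  The chain rule at time \<open>0\<close> expresses the right derivative of the value along the trajectory
  through \<open>x\<close> by any gradient relative to \<open>X\<close>, because the trajectory stays in \<open>X\<close>.
\<close>

lemma policy_value_lie_derivative_nonpos:
  assumes wp: "closed_loop_well_posed X f g \<pi>" and "x \<in> X"
    and bdd: "bdd_above ((\<lambda>t. h (closed_loop_state X f g \<pi> x t)) ` {0..})"
    and G: "continuous_gradient_on X (policy_value X f g h \<pi>) G"
  shows "lie_vector G f x + lie_matrix G g x \<bullet> \<pi> x \<le> 0"
proof -
  let ?V = "policy_value X f g h \<pi>" and ?\<xi> = "closed_loop_state X f g \<pi> x"
  let ?v = "f x + g x *v \<pi> x"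
  have sol: "closed_loop_solution X f g \<pi> x ?\<xi>"
    by (rule closed_loop_state_solution) fact+
  then have start: "?\<xi> 0 = x" and stays: "?\<xi> ` {0..} \<subseteq> X"
    unfolding closed_loop_solution_def by auto
  have \<xi>': "(?\<xi> has_derivative (\<lambda>t. t *\<^sub>R ?v)) (at 0 within {0..})"
    using sol start unfolding closed_loop_solution_def has_vector_derivative_def by fastforce
  have "(?V has_derivative (\<lambda>v. G x \<bullet> v)) (at (?\<xi> 0) within ?\<xi> ` {0..})"
    using G \<open>x \<in> X\<close> start stays
    by (auto simp: continuous_gradient_on_def intro: has_derivative_subset)
  from diff_chain_within[OF \<xi>' this]
  have "((?V \<circ> ?\<xi>) has_real_derivative G x \<bullet> ?v) (at 0 within {0..})"
    by (simp add: has_field_derivative_def o_def mult_commute_abs)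
  then have "G x \<bullet> ?v \<le> 0"
  proof (rule right_derivative_nonpos_at_max)
    fix t :: real
    assume "t \<ge> 0"
    then show "(?V \<circ> ?\<xi>) t \<le> (?V \<circ> ?\<xi>) 0"
      using policy_value_antimono_along_trajectory[OF wp \<open>x \<in> X\<close> _ bdd] start by simp
  qed
  then show ?thesis
    by (simp add: lie_vector_def lie_matrix_def inner_add_right dot_lmul_matrix)
qed

theorem theorem1:
  fixes X :: "(real^'n) set" and U :: "(real^'m) set"
    and f :: "real^'n \<Rightarrow> real^'n" and g :: "real^'n \<Rightarrow> real^'m^'n"
    and h :: "real^'n \<Rightarrow> real" and \<pi> :: "real^'n \<Rightarrow> real^'m" and \<alpha> :: "real \<Rightarrow> real"
  assumes "locally_lipschitz_on X f" and "locally_lipschitz_on X g"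
    and "continuous_on X h"
    and "\<And>x. x \<in> X \<Longrightarrow> \<pi> x \<in> U"
    and "extended_class_kappa \<alpha>"
    and "closed_loop_well_posed X f g \<pi>"
    and "\<And>x0. x0 \<in> X \<Longrightarrow> bdd_above ((\<lambda>t. h (closed_loop_state X f g \<pi> x0 t)) ` {0..})"
    and "continuously_differentiable_on X (policy_value X f g h \<pi>)"
  shows "control_barrier_function X U f g (avoid_set X h) \<alpha> (policy_value X f g h \<pi>)"
  unfolding control_barrier_function_def
proof (intro conjI ballI allI impI)
  fix x
  assume "x \<in> avoid_set X h"
  then have "x \<in> X" "h x > 0"
    by (auto simp: avoid_set_def)
  with le_policy_value[OF assms(6) _ assms(7)] show "policy_value X f g h \<pi> x > 0"
    by force
next
  fix G x
  assume G: "continuous_gradient_on X (policy_value X f g h \<pi>) G"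
    and "x \<in> X" and V: "policy_value X f g h \<pi> x \<le> 0"
  have "(INF u\<in>U. ereal (lie_vector G f x + lie_matrix G g x \<bullet> u))
      \<le> ereal (lie_vector G f x + lie_matrix G g x \<bullet> \<pi> x)"
    by (rule INF_lower) (rule assms(4)[OF \<open>x \<in> X\<close>])
  also have "\<dots> \<le> ereal 0"
    using policy_value_lie_derivative_nonpos[OF assms(6) \<open>x \<in> X\<close> assms(7)[OF \<open>x \<in> X\<close>] G] by simp
  also have "\<dots> \<le> ereal (- \<alpha> (policy_value X f g h \<pi> x))"
  proof -
    have "\<alpha> (policy_value X f g h \<pi> x) \<le> \<alpha> 0"
      using assms(5) V unfolding extended_class_kappa_def by (metis strict_mono_less_eq)
    with assms(5) show ?thesis
      by (simp add: extended_class_kappa_def)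
  qed
  finally show "(INF u\<in>U. ereal (lie_vector G f x + lie_matrix G g x \<bullet> u))
      \<le> ereal (- \<alpha> (policy_value X f g h \<pi> x))" .
qed (rule assms(8))

end
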